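(* In the universal enveloping algebra of the complex Lie superalgebra $SU(2/1)$, the ghost Casimir $T$ and the quadratic Casimir $C_2$ satisfy the identity $T^2=(C_2)^2$.
   Context: $SU(2/1)$ denotes the complex Lie superalgebra $sl(2/1,\mathbb{C})$ with even generators $F,H,E,Y$ and odd generators $U,V,W,X$ and relations: $[H,E]=2E$, $[H,F]=-2F$, $[E,F]=H$, $Y$ commutes with $E,F,H$; $[H,U]=-U$, $[H,W]=W$, $[H,X]=-X$, $[H,V]=V$; $[Y,U]=U$, $[Y,W]=W$, $[Y,V]=-V$, $[Y,X]=-X$; $[E,U]=W$, $[F,W]=U$, $[E,X]=-V$, $[F,V]=-X$, $[E,V]=[E,W]=[F,U]=[F,X]=0$; $\{U,V\}=\tfrac12(Y+H)$, $\{W,X\}=\tfrac12(Y-H)$, $\{U,X\}=-F$, $\{V,W\}=-E$, $\{U,W\}=\{X,V\}=0$, and $U,V,W,X$ square to zero in the enveloping algebra. $C_2=-\tfrac14\big(H^2-Y^2+2(EF+FE)+2(UV-VU)+2(WX-XW)\big)$. $T$ is defined by $6T=-(UV-VU)-(WX-XW)+\sum_{\sigma}\mathrm{sgn}(\sigma)\,Z_{\sigma(1)}Z_{\sigma(2)}Z_{\sigma(3)}Z_{\sigma(4)}$, where $(Z_1,Z_2,Z_3,Z_4)=(U,V,W,X)$ and $\sigma$ ranges over all 24 permutations. *)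

theory Defs
  imports Complex_Main "HOL-Library.Poly_Mapping" "HOL-Combinatorics.Permutations"
begin

section \<open>The Lie superalgebra \<open>sl(2/1)\<close>\<close>

datatype sl21_basis = bF | bH | bE | bY | bU | bV | bW | bX

lemma UNIV_sl21_basis: "UNIV = {bF, bH, bE, bY, bU, bV, bW, bX}"
  by (auto intro: sl21_basis.exhaust)

instance sl21_basis :: finite
  by standard (simp add: UNIV_sl21_basis)

type_synonym sl21 = "sl21_basis \<Rightarrow>\<^sub>0 complex"

abbreviation basis :: "sl21_basis \<Rightarrow> sl21" where
  "basis b \<equiv> Poly_Mapping.single b 1"

abbreviation scale :: "complex \<Rightarrow> sl21 \<Rightarrow> sl21" where
  "scale c \<equiv> Poly_Mapping.map ((*) c)"

definition odd_basis :: "sl21_basis \<Rightarrow> bool" where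
  "odd_basis b \<longleftrightarrow> b \<in> {bU, bV, bW, bX}"

text \<open>The homogeneous component of parity \<open>p\<close>; \<open>True\<close> stands for odd.\<close>

definition homogeneous :: "bool \<Rightarrow> sl21 set" where
  "homogeneous p = {v. \<forall>b. Poly_Mapping.lookup v b \<noteq> 0 \<longrightarrow> odd_basis b = p}"

definition koszul :: "bool \<Rightarrow> bool \<Rightarrow> 'a::ring_1" where
  "koszul p q = (if p \<and> q then - 1 else 1)"

text \<open>Each nonzero bracket of two basis elements is listed in one order only; the other
  order, and the value \<open>0\<close> on the diagonal, come from super-antisymmetry in
  \<open>basis_bracket\<close>.\<close>

fun listed_bracket :: "sl21_basis \<Rightarrow> sl21_basis \<Rightarrow> sl21" where
  "listed_bracket bH bE = Poly_Mapping.single bE 2"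
| "listed_bracket bH bF = Poly_Mapping.single bF (- 2)"
| "listed_bracket bE bF = basis bH"
| "listed_bracket bH bU = - basis bU"
| "listed_bracket bH bW = basis bW"
| "listed_bracket bH bX = - basis bX"
| "listed_bracket bH bV = basis bV"
| "listed_bracket bY bU = basis bU"
| "listed_bracket bY bW = basis bW"
| "listed_bracket bY bV = - basis bV"
| "listed_bracket bY bX = - basis bX"
| "listed_bracket bE bU = basis bW"
| "listed_bracket bF bW = basis bU"
| "listed_bracket bE bX = - basis bV"
| "listed_bracket bF bV = - basis bX"
| "listed_bracket bU bV = Poly_Mapping.single bY (1/2) + Poly_Mapping.single bH (1/2)"
| "listed_bracket bW bX = Poly_Mapping.single bY (1/2) - Poly_Mapping.single bH (1/2)"
| "listed_bracket bU bX = - basis bF"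
| "listed_bracket bV bW = - basis bE"
| "listed_bracket _ _ = 0"

definition basis_bracket :: "sl21_basis \<Rightarrow> sl21_basis \<Rightarrow> sl21" where
  "basis_bracket a b =
     listed_bracket a b - scale (koszul (odd_basis a) (odd_basis b)) (listed_bracket b a)"

definition super_bracket :: "sl21 \<Rightarrow> sl21 \<Rightarrow> sl21" where
  "super_bracket v w =
     (\<Sum>a\<in>UNIV. \<Sum>b\<in>UNIV. scale (Poly_Mapping.lookup v a * Poly_Mapping.lookup w b) (basis_bracket a b))"

lemma lookup_scale [simp]: "Poly_Mapping.lookup (scale c v) b = c * Poly_Mapping.lookup v b"
  by (simp add: Poly_Mapping.map.rep_eq when_def)

lemma lookup_super_bracket:
  "Poly_Mapping.lookup (super_bracket v w) c =
     (\<Sum>a\<in>UNIV. \<Sum>b\<in>UNIV. Poly_Mapping.lookup v a * Poly_Mapping.lookup w b * Poly_Mapping.lookup (basis_bracket a b) c)"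
  by (simp add: super_bracket_def lookup_sum)

lemma super_bracket_basis: "super_bracket (basis a) (basis b) = basis_bracket a b"
  by (rule poly_mapping_eqI, cases a; cases b)
    (simp_all add: lookup_super_bracket UNIV_sl21_basis lookup_single)

lemma super_bracket_antisym:
  "super_bracket (basis a) (basis b) =
     - scale (koszul (odd_basis a) (odd_basis b)) (super_bracket (basis b) (basis a))"
  unfolding super_bracket_basis
  by (rule poly_mapping_eqI)
    (simp add: basis_bracket_def lookup_minus koszul_def)

lemma super_jacobi:
  "super_bracket (basis a) (super_bracket (basis b) (basis c)) =
     super_bracket (super_bracket (basis a) (basis b)) (basis c)
     + scale (koszul (odd_basis a) (odd_basis b))
         (super_bracket (basis b) (super_bracket (basis a) (basis c)))"
proof -
  have L: "Poly_Mapping.lookup (super_bracket (basis x) v) d =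
      (\<Sum>b\<in>UNIV. Poly_Mapping.lookup v b * Poly_Mapping.lookup (basis_bracket x b) d)" for x v d
    by (cases x) (simp_all add: lookup_super_bracket UNIV_sl21_basis lookup_single)
  have R: "Poly_Mapping.lookup (super_bracket v (basis x)) d =
      (\<Sum>a\<in>UNIV. Poly_Mapping.lookup v a * Poly_Mapping.lookup (basis_bracket a x) d)" for x v d
    by (cases x) (simp_all add: lookup_super_bracket UNIV_sl21_basis lookup_single)
  show ?thesis
    by (rule poly_mapping_eqI, unfold lookup_add lookup_scale L R super_bracket_basis,
        cases a; cases b; cases c)
      (simp_all add: UNIV_sl21_basis basis_bracket_def koszul_def odd_basis_def lookup_add
        lookup_minus lookup_single when_def)
qed


section \<open>The universal enveloping algebra\<close>

text \<open>The tensor algebra of a vector space with a given basis is the free algebra on that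
  basis, that is, the monoid algebra of the free monoid of words.\<close>

datatype 'a word = Word (letters: "'a list")

instantiation word :: (type) monoid_add
begin

definition zero_word :: "'a word" where "0 = Word []"
definition plus_word :: "'a word \<Rightarrow> 'a word \<Rightarrow> 'a word" where
  "u + v = Word (letters u @ letters v)"

instance
  by standard (simp_all add: zero_word_def plus_word_def)

end

type_synonym tensor_sl21 = "sl21_basis word \<Rightarrow>\<^sub>0 complex"

definition tensor_embed :: "sl21 \<Rightarrow> tensor_sl21" where
  "tensor_embed v = (\<Sum>b\<in>UNIV. Poly_Mapping.single (Word [b]) (Poly_Mapping.lookup v b))"

inductive_set two_sided_ideal :: "'a::ring_1 set \<Rightarrow> 'a set" for S where
  zero: "0 \<in> two_sided_ideal S"
| generator: "s \<in> S \<Longrightarrow> s \<in> two_sided_ideal S"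
| add: "x \<in> two_sided_ideal S \<Longrightarrow> y \<in> two_sided_ideal S \<Longrightarrow> x + y \<in> two_sided_ideal S"
| mult_left: "x \<in> two_sided_ideal S \<Longrightarrow> r * x \<in> two_sided_ideal S"
| mult_right: "x \<in> two_sided_ideal S \<Longrightarrow> x * r \<in> two_sided_ideal S"

definition env_relators :: "tensor_sl21 set" where
  "env_relators =
     {tensor_embed x * tensor_embed y - koszul p q * (tensor_embed y * tensor_embed x)
        - tensor_embed (super_bracket x y) |
      x y p q. x \<in> homogeneous p \<and> y \<in> homogeneous q}"

abbreviation env_ideal :: "tensor_sl21 set" where
  "env_ideal \<equiv> two_sided_ideal env_relators"

lemma two_sided_ideal_uminus: "x \<in> two_sided_ideal S \<Longrightarrow> - x \<in> two_sided_ideal S"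
  using two_sided_ideal.mult_left[of x S "- 1"] by simp

lemma two_sided_ideal_diff:
  "x \<in> two_sided_ideal S \<Longrightarrow> y \<in> two_sided_ideal S \<Longrightarrow> x - y \<in> two_sided_ideal S"
  using two_sided_ideal.add[of x S "- y"] two_sided_ideal_uminus by fastforce

quotient_type env_sl21 = tensor_sl21 / "\<lambda>a b. a - b \<in> env_ideal"
proof (rule equivpI)
  show "reflp (\<lambda>a b. a - b \<in> env_ideal)"
    by (simp add: reflp_def two_sided_ideal.zero)
  show "symp (\<lambda>a b. a - b \<in> env_ideal)"
    using two_sided_ideal_uminus by (fastforce simp: symp_def)
  show "transp (\<lambda>a b. a - b \<in> env_ideal)"
    using two_sided_ideal.add by (fastforce simp: transp_def)
qed

text \<open>The augmentation (constant coefficient) vanishes on the ideal, so the quotient is not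
  the zero ring.\<close>

lemma lookup_mult_empty_word:
  fixes a b :: tensor_sl21
  shows "Poly_Mapping.lookup (a * b) 0 = Poly_Mapping.lookup a 0 * Poly_Mapping.lookup b 0"
proof -
  have e: "(0 = u + v) \<longleftrightarrow> u = 0 \<and> v = 0" for u v :: "sl21_basis word"
    by (cases u; cases v) (auto simp: zero_word_def plus_word_def)
  have "Poly_Mapping.lookup (a * b) 0 =
      Sum_any (\<lambda>u. Poly_Mapping.lookup a u *
        Sum_any (\<lambda>v. Poly_Mapping.lookup b v when v = 0 \<and> u = 0))"
    by (simp add: lookup_mult e conj_commute)
  also have "\<dots> =
      Sum_any (\<lambda>u. (Poly_Mapping.lookup a u * Poly_Mapping.lookup b 0) when u = 0)"
    by (intro Sum_any.cong) (auto simp: when_def)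
  finally show ?thesis by simp
qed

lemma lookup_env_ideal_empty_word:
  assumes "a \<in> env_ideal" shows "Poly_Mapping.lookup a 0 = 0"
proof -
  have e: "Poly_Mapping.lookup (tensor_embed v) 0 = 0" for v
    by (simp add: tensor_embed_def lookup_sum lookup_single zero_word_def when_def)
  show ?thesis
    using assms
    by induction
      (auto simp: env_relators_def lookup_minus lookup_add lookup_mult_empty_word e)
qed

instantiation env_sl21 :: ring_1
begin

lift_definition zero_env_sl21 :: env_sl21 is 0 .
lift_definition one_env_sl21 :: env_sl21 is 1 .

lift_definition plus_env_sl21 :: "env_sl21 \<Rightarrow> env_sl21 \<Rightarrow> env_sl21" is "(+)"
proof -
  fix a a' b b' :: tensor_sl21
  assume "a - a' \<in> env_ideal" "b - b' \<in> env_ideal"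
  then show "a + b - (a' + b') \<in> env_ideal"
    using two_sided_ideal.add by (fastforce simp: algebra_simps)
qed

lift_definition minus_env_sl21 :: "env_sl21 \<Rightarrow> env_sl21 \<Rightarrow> env_sl21" is "(-)"
proof -
  fix a a' b b' :: tensor_sl21
  assume "a - a' \<in> env_ideal" "b - b' \<in> env_ideal"
  then have "(a - a') - (b - b') \<in> env_ideal" by (rule two_sided_ideal_diff)
  then show "a - b - (a' - b') \<in> env_ideal" by (simp add: algebra_simps)
qed

lift_definition uminus_env_sl21 :: "env_sl21 \<Rightarrow> env_sl21" is uminus
  using two_sided_ideal_uminus by fastforce

lift_definition times_env_sl21 :: "env_sl21 \<Rightarrow> env_sl21 \<Rightarrow> env_sl21" is "(*)"
proof -
  fix a a' b b' :: tensor_sl21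
  assume "a - a' \<in> env_ideal" "b - b' \<in> env_ideal"
  then have "(a - a') * b + a' * (b - b') \<in> env_ideal"
    by (intro two_sided_ideal.add two_sided_ideal.mult_left two_sided_ideal.mult_right)
  then show "a * b - a' * b' \<in> env_ideal" by (simp add: algebra_simps)
qed

instance
proof
  show "(0::env_sl21) \<noteq> 1"
    by transfer (auto simp: lookup_minus dest!: lookup_env_ideal_empty_word)
qed (transfer; simp add: algebra_simps two_sided_ideal.zero)+

end

lift_definition env_scale :: "complex \<Rightarrow> env_sl21 \<Rightarrow> env_sl21" (infixr "*\<^sub>C" 75)
  is "\<lambda>c a. Poly_Mapping.single 0 c * a"
  using two_sided_ideal.mult_left by (fastforce simp flip: right_diff_distrib)

lift_definition env_embed :: "sl21 \<Rightarrow> env_sl21" is tensor_embed .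

lemma env_embed_add: "env_embed (v + w) = env_embed v + env_embed w"
  by transfer
    (simp add: tensor_embed_def lookup_add single_add sum.distrib two_sided_ideal.zero)

lemma env_embed_scale: "env_embed (scale c v) = c *\<^sub>C env_embed v"
  by transfer
    (simp add: tensor_embed_def sum_distrib_left mult_single two_sided_ideal.zero)

lemma env_super_commutator:
  assumes "x \<in> homogeneous p" "y \<in> homogeneous q"
  shows "env_embed x * env_embed y - koszul p q * (env_embed y * env_embed x) =
    env_embed (super_bracket x y)"
proof -
  have "tensor_embed x * tensor_embed y - koszul p q * (tensor_embed y * tensor_embed x)
      - tensor_embed (super_bracket x y) \<in> env_ideal"
    using assms unfolding env_relators_def by (intro two_sided_ideal.generator) blast
  then have "abs_env_sl21 (tensor_embed x * tensor_embed y
      - koszul p q * (tensor_embed y * tensor_embed x)) =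
      abs_env_sl21 (tensor_embed (super_bracket x y))"
    by (simp only: env_sl21.abs_eq_iff)
  moreover have "abs_env_sl21 (koszul p q) = koszul p q"
    by (simp add: koszul_def one_env_sl21_def flip: uminus_env_sl21.abs_eq)
  ultimately show ?thesis
    by (simp add: env_embed.abs_eq flip: minus_env_sl21.abs_eq times_env_sl21.abs_eq)
qed

lemma env_super_commutator_basis:
  "env_embed (basis a) * env_embed (basis b)
     - koszul (odd_basis a) (odd_basis b) * (env_embed (basis b) * env_embed (basis a)) =
   env_embed (basis_bracket a b)"
proof -
  have "basis c \<in> homogeneous (odd_basis c)" for c
    by (simp add: homogeneous_def lookup_single when_def)
  from env_super_commutator[OF this this] show ?thesis
    by (simp add: super_bracket_basis)
qed

lemma env_odd_square:
  assumes "odd_basis b"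
  shows "env_embed (basis b) * env_embed (basis b) = 0"
proof -
  define s where "s = env_embed (basis b) * env_embed (basis b)"
  have "basis_bracket b b = 0"
    by (rule poly_mapping_eqI, cases b) (simp_all add: basis_bracket_def lookup_minus)
  moreover have "env_embed 0 = 0"
    using env_embed_add[of 0 0] by simp
  ultimately have "s + s = 0"
    using env_super_commutator_basis[of b b] assms by (simp add: s_def koszul_def)
  moreover have "(1/2) *\<^sub>C (s + s) = s"
  proof transfer
    fix s :: tensor_sl21
    have "Poly_Mapping.single 0 (1/2) * (s + s) =
        (Poly_Mapping.single 0 (1/2) + Poly_Mapping.single 0 (1/2)) * s"
      by (simp only: distrib_left distrib_right)
    also have "\<dots> = s" by (simp flip: single_add)
    finally show "Poly_Mapping.single 0 (1/2) * (s + s) - s \<in> env_ideal"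
      by (simp add: two_sided_ideal.zero)
  qed
  moreover have "(1/2) *\<^sub>C (0::env_sl21) = 0"
    by transfer (simp add: two_sided_ideal.zero)
  ultimately show ?thesis by (simp add: s_def)
qed

abbreviation "F \<equiv> env_embed (basis bF)"
abbreviation "H \<equiv> env_embed (basis bH)"
abbreviation "E \<equiv> env_embed (basis bE)"
abbreviation "Y \<equiv> env_embed (basis bY)"
abbreviation "U \<equiv> env_embed (basis bU)"
abbreviation "V \<equiv> env_embed (basis bV)"
abbreviation "W \<equiv> env_embed (basis bW)"
abbreviation "X \<equiv> env_embed (basis bX)"


section \<open>The Casimir elements\<close>

definition C2 :: env_sl21 where
  "C2 = - ((1/4) *\<^sub>C (H^2 - Y^2 + 2 * (E * F + F * E) + 2 * (U * V - V * U) + 2 * (W * X - X * W)))"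

text \<open>The indices of \<open>Z\<close> run over \<open>0, \<dots>, 3\<close>.\<close>

definition Z :: "nat \<Rightarrow> env_sl21" where
  "Z i = [U, V, W, X] ! i"

definition T :: env_sl21 where
  "T = (1/6) *\<^sub>C
     (- (U * V - V * U) - (W * X - X * W)
      + (\<Sum>\<sigma> | \<sigma> permutes {..<4}. of_int (sign \<sigma>) * (Z (\<sigma> 0) * Z (\<sigma> 1) * Z (\<sigma> 2) * Z (\<sigma> 3))))"

end

(* In terms of K = (Y + H)/2 and L = (Y - H)/2 all structure constants of sl(2/1) are integers,
   and so are the coefficients of A = (T + C2)/2 and B = (T - C2)/2 in the PBW basis ordered as
   F, K, L, E, U, V, W, X. Rewriting products into this basis shows A B = B A = 0. Hence
   T^2 = (A + B)^2 = (A - B)^2 = C2^2. *)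

theory Submission
  imports Defs
begin

text \<open>One rule for each of the 28 pairs of generators standing against the order F, K, L, E,
  U, V, W, X, and one for each odd square. Every rule sorts an adjacent pair or shortens the word,
  so rewriting terminates. All coefficients are 1 or -1, so no complex scalars are needed
  here.\<close>

locale sl21_relations =
  fixes F K L E U V W X :: "'a::ring_1"
  assumes even_even:
      "K * F = F * K - F" "L * F = F * L + F" "L * K = K * L"
      "E * F = F * E + K - L" "E * K = K * E - E" "E * L = L * E + E"
    and odd_even:
      "U * F = F * U" "U * K = K * U" "U * L = L * U - U" "U * E = E * U - W"
      "V * F = F * V + X" "V * K = K * V" "V * L = L * V + V" "V * E = E * V"
      "W * F = F * W - U" "W * K = K * W - W" "W * L = L * W" "W * E = E * W"
      "X * F = F * X" "X * K = K * X + X" "X * L = L * X" "X * E = E * X + V"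
    and odd_odd:
      "V * U = K - U * V" "W * U = - (U * W)" "X * U = - F - U * X"
      "W * V = - E - V * W" "X * V = - (V * X)" "X * W = L - W * X"
    and odd_square:
      "U * U = 0" "V * V = 0" "W * W = 0" "X * X = 0"
begin

lemmas relations = even_even odd_even odd_odd odd_square

text \<open>Completes the rewrite system: products associate to the right, so an inverted pair can also
  occur in front of a further factor.\<close>

lemmas relations_assoc = relations[THEN arg_cong[where f = "\<lambda>x. x * r" for r],
    unfolded mult.assoc distrib_right left_diff_distrib mult_minus_left mult_zero_left]

text \<open>The part of \<open>A\<close> and \<open>B\<close> of degree above two. It cancels in
  \<open>A - B\<close>, as it must, since \<open>C2\<close> is quadratic.\<close>

definition cubic_quartic :: 'a where
  "cubic_quartic = 2 * (U * V * W * X) - L * U * V - K * W * X + E * U * X + F * V * W"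

definition A :: 'a where
  "A = K * L + L - 2 * (W * X) + cubic_quartic"

definition B :: 'a where
  "B = F * E + U * V - W * X + cubic_quartic"

text \<open>Together with \<open>mult_2\<close> this turns the outer factors 4 and 6 into repeated
  addition, so that both sides become plain sums of ordered monomials.\<close>

lemma expand_numeral:
  fixes x :: 'a
  shows "4 * x = 2 * (2 * x)" "6 * x = 2 * x + (2 * x + 2 * x)"
  by (simp_all flip: mult.assoc distrib_right)

lemmas pbw_rewrites = relations relations_assoc mult_2 mult.assoc distrib_left distrib_right
  left_diff_distrib right_diff_distrib

lemma A_mult_B: "A * B = 0"
  unfolding A_def B_def cubic_quartic_def by (simp add: pbw_rewrites)

lemma B_mult_A: "B * A = 0"
  unfolding A_def B_def cubic_quartic_def by (simp add: pbw_rewrites)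

text \<open>Here \<open>K - L\<close> and \<open>K + L\<close> stand for H and Y.\<close>

lemma quadratic_casimir:
  "(K - L)^2 - (K + L)^2 + 2 * (E * F + F * E) + 2 * (U * V - V * U) + 2 * (W * X - X * W)
     = 4 * (B - A)"
  unfolding A_def B_def cubic_quartic_def power2_eq_square
  by (simp add: pbw_rewrites expand_numeral)

lemma ghost_casimir:
  "- (U * V - V * U) - (W * X - X * W) +
     (U * V * W * X - U * V * X * W - U * W * V * X + U * W * X * V + U * X * V * W - U * X * W * V
      - V * U * W * X + V * U * X * W + V * W * U * X - V * W * X * U - V * X * U * W + V * X * W * U
      + W * U * V * X - W * U * X * V - W * V * U * X + W * V * X * U + W * X * U * V - W * X * V * U
      - X * U * V * W + X * U * W * V + X * V * U * W - X * V * W * U - X * W * U * V + X * W * V * U)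
     = 6 * (A + B)"
  unfolding A_def B_def cubic_quartic_def
  by (simp add: pbw_rewrites expand_numeral)

text \<open>The two squares differ by \<open>2 * (A * B + B * A)\<close>, and both products
  vanish.\<close>

lemma square_sum_eq_square_diff: "(A + B)^2 = (A - B)^2"
  by (simp add: power2_eq_square algebra_simps A_mult_B B_mult_A)

end

text \<open>A permutation of \<open>insert a S\<close> factors uniquely as
  \<open>transpose a b \<circ> q\<close> with \<open>q\<close> fixing \<open>a\<close>, and the
  transposition flips the sign unless \<open>a = b\<close>. Iterating this expands a signed sum
  explicitly.\<close>

lemma sum_sign_permutes_insert:
  fixes g :: "('a \<Rightarrow> 'a) \<Rightarrow> 'b::ring_1"
  assumes "finite S" "a \<notin> S"
  shows "(\<Sum>p | p permutes insert a S. of_int (sign p) * g p) =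
    (\<Sum>b\<in>insert a S. (if a = b then 1 else - 1) *
      (\<Sum>q | q permutes S. of_int (sign q) * g (transpose a b \<circ> q)))"
proof -
  have "of_int (sign (transpose a b \<circ> q)) = (if a = b then 1 else - 1) * (of_int (sign q) :: 'b)"
    if "q permutes S" for b q
  proof -
    have "permutation q"
      using that \<open>finite S\<close> permutation_permutes by blast
    then show ?thesis
      by (simp add: sign_compose sign_swap_id permutation_swap_id)
  qed
  then show ?thesis
    unfolding sum_over_permutations_insert[OF assms] sum_distrib_left
    by (intro sum.cong refl) (simp add: mult.assoc)
qed

lemma antisymmetrizer_4:
  fixes z :: "nat \<Rightarrow> 'a::ring_1"
  shows "(\<Sum>\<sigma> | \<sigma> permutes {..<4}. of_int (sign \<sigma>) * (z (\<sigma> 0) * z (\<sigma> 1) * z (\<sigma> 2) * z (\<sigma> 3))) =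
    (let u = z 0; v = z 1; w = z 2; x = z 3 in
       u * v * w * x - u * v * x * w - u * w * v * x + u * w * x * v + u * x * v * w - u * x * w * v
      - v * u * w * x + v * u * x * w + v * w * u * x - v * w * x * u - v * x * u * w + v * x * w * u
      + w * u * v * x - w * u * x * v - w * v * u * x + w * v * x * u + w * x * u * v - w * x * v * u
      - x * u * v * w + x * u * w * v + x * v * u * w - x * v * w * u - x * w * u * v + x * w * v * u)"
proof -
  \<comment> \<open>As an iterated \<open>insert\<close>, the index set can be peeled off one
    element at a time.\<close>
  have "{..<4} = {0, 1, 2, 3 :: nat}" by auto
  then show ?thesis
    by (simp add: sum_sign_permutes_insert transpose_def Let_def)
qed

lemma env_scale_one: "1 *\<^sub>C a = a"
  by transfer (simp add: two_sided_ideal.zero)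

lemma env_scale_minus_one: "(- 1) *\<^sub>C a = - a"
  by transfer (simp add: single_uminus two_sided_ideal.zero)

lemma env_scale_zero: "0 *\<^sub>C a = 0"
  by transfer (simp add: two_sided_ideal.zero)

lemma env_scale_add_left: "(c + d) *\<^sub>C a = c *\<^sub>C a + d *\<^sub>C a"
  by transfer (simp add: single_add distrib_right two_sided_ideal.zero)

lemma env_scale_scale: "c *\<^sub>C d *\<^sub>C a = (c * d) *\<^sub>C a"
  by transfer (simp add: mult_single two_sided_ideal.zero flip: mult.assoc)

lemma env_scale_of_nat: "of_nat n *\<^sub>C a = of_nat n * a"
  by (induction n) (simp_all add: env_scale_zero env_scale_add_left env_scale_one distrib_right)

text \<open>Lets the scalars 1/4 and 1/6 of \<open>C2\<close> and \<open>T\<close> cancel the ring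
  elements 4 and 6.\<close>

lemma env_scale_numeral_mult: "c *\<^sub>C (numeral n * a) = (c * numeral n) *\<^sub>C a"
  using env_scale_of_nat[of "numeral n" a] by (simp flip: env_scale_scale)

lemma env_embed_zero: "env_embed 0 = 0"
  using env_embed_add[of 0 0] by simp

lemma env_embed_uminus: "env_embed (- v) = - env_embed v"
  using env_embed_add[of v "- v"] by (simp add: env_embed_zero eq_neg_iff_add_eq_0 add.commute)

lemma env_embed_diff: "env_embed (v - w) = env_embed v - env_embed w"
  using env_embed_add[of v "- w"] by (simp add: env_embed_uminus)

text \<open>The bracket of U and V, written exactly as in \<open>listed_bracket\<close> so that it
  can be folded; likewise \<open>Lvec\<close> for W and X.\<close>

definition Kvec :: sl21 where
  "Kvec = Poly_Mapping.single bY (1/2) + Poly_Mapping.single bH (1/2)"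

definition Lvec :: sl21 where
  "Lvec = Poly_Mapping.single bY (1/2) - Poly_Mapping.single bH (1/2)"

lemma H_eq: "H = env_embed Kvec - env_embed Lvec"
  by (simp add: Kvec_def Lvec_def flip: env_embed_diff single_add)

lemma Y_eq: "Y = env_embed Kvec + env_embed Lvec"
  by (simp add: Kvec_def Lvec_def flip: env_embed_add single_add)

lemma homogeneous_basis: "basis b \<in> homogeneous (odd_basis b)"
  by (simp add: homogeneous_def lookup_single when_def)

lemma homogeneous_Kvec: "Kvec \<in> homogeneous False"
  by (auto simp: homogeneous_def Kvec_def lookup_add lookup_single when_def odd_basis_def)

lemma homogeneous_Lvec: "Lvec \<in> homogeneous False"
  by (auto simp: homogeneous_def Lvec_def lookup_minus lookup_single when_def odd_basis_def)

text \<open>The adjoint action of \<open>Kvec\<close> is diagonal in the given basis, with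
  eigenvalues 0, 1 and -1: this is what makes the relations integral.\<close>

lemma super_bracket_Kvec:
  "super_bracket Kvec (basis b) =
    scale (if b \<in> {bE, bW} then 1 else if b \<in> {bF, bX} then - 1 else 0) (basis b)"
  by (rule poly_mapping_eqI, unfold Kvec_def, cases b)
    (simp_all add: lookup_super_bracket UNIV_sl21_basis basis_bracket_def odd_basis_def koszul_def
      lookup_add lookup_minus lookup_single when_def)

lemma super_bracket_Lvec:
  "super_bracket Lvec (basis b) =
    scale (if b \<in> {bF, bU} then 1 else if b \<in> {bE, bV} then - 1 else 0) (basis b)"
  by (rule poly_mapping_eqI, unfold Lvec_def, cases b)
    (simp_all add: lookup_super_bracket UNIV_sl21_basis basis_bracket_def odd_basis_def koszul_def
      lookup_add lookup_minus lookup_single when_def)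

lemma super_bracket_Lvec_Kvec: "super_bracket Lvec Kvec = 0"
  by (rule poly_mapping_eqI, unfold Lvec_def Kvec_def)
    (simp add: lookup_super_bracket UNIV_sl21_basis basis_bracket_def odd_basis_def koszul_def
      lookup_add lookup_minus lookup_single when_def)

lemma Kvec_commutator:
  "env_embed Kvec * env_embed (basis b) = env_embed (basis b) * env_embed Kvec +
     (if b \<in> {bE, bW} then env_embed (basis b)
      else if b \<in> {bF, bX} then - env_embed (basis b) else 0)"
  using env_super_commutator[OF homogeneous_Kvec homogeneous_basis[of b]]
  unfolding super_bracket_Kvec env_embed_scale
  by (auto simp: koszul_def env_scale_one env_scale_minus_one env_scale_zero algebra_simps
      split: if_splits)

lemma Lvec_commutator:
  "env_embed Lvec * env_embed (basis b) = env_embed (basis b) * env_embed Lvec +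
     (if b \<in> {bF, bU} then env_embed (basis b)
      else if b \<in> {bE, bV} then - env_embed (basis b) else 0)"
  using env_super_commutator[OF homogeneous_Lvec homogeneous_basis[of b]]
  unfolding super_bracket_Lvec env_embed_scale
  by (auto simp: koszul_def env_scale_one env_scale_minus_one env_scale_zero algebra_simps
      split: if_splits)

lemma Lvec_Kvec_commute: "env_embed Lvec * env_embed Kvec = env_embed Kvec * env_embed Lvec"
  using env_super_commutator[OF homogeneous_Lvec homogeneous_Kvec]
  by (simp add: super_bracket_Lvec_Kvec env_embed_zero koszul_def)

lemma env_embed_basis_bracket:
  "env_embed (basis_bracket a b) =
     env_embed (listed_bracket a b)
       - koszul (odd_basis a) (odd_basis b) * env_embed (listed_bracket b a)"
  unfolding basis_bracket_def env_embed_diff env_embed_scale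
  by (simp add: koszul_def env_scale_one env_scale_minus_one)

text \<open>The exchange rule for two basis elements. Both listed brackets occur because either
  order may be the listed one; the other then contributes 0.\<close>

lemma basis_product:
  "env_embed (basis a) * env_embed (basis b) =
     koszul (odd_basis a) (odd_basis b)
       * (env_embed (basis b) * env_embed (basis a) - env_embed (listed_bracket b a))
     + env_embed (listed_bracket a b)"
  using env_super_commutator_basis[of a b] unfolding env_embed_basis_bracket
  by (simp add: algebra_simps)

interpretation sl21: sl21_relations F "env_embed Kvec" "env_embed Lvec" E U V W X
  \<comment> \<open>\<open>basis_product\<close> is instantiated only at pairs in the wrong order,
    so as a rewrite rule it does not loop.\<close>
  by standard
    (simp_all add: Kvec_commutator Lvec_commutator Lvec_Kvec_commute env_odd_square odd_basis_def
      koszul_def env_embed_zero env_embed_uminus H_eq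
      basis_product[of bE bF] basis_product[of bU bF] basis_product[of bU bE]
      basis_product[of bV bF] basis_product[of bV bE] basis_product[of bW bF]
      basis_product[of bW bE] basis_product[of bX bF] basis_product[of bX bE]
      basis_product[of bV bU] basis_product[of bW bU] basis_product[of bX bU]
      basis_product[of bW bV] basis_product[of bX bV] basis_product[of bX bW]
      flip: Kvec_def Lvec_def)

theorem mainTheorem3:
  shows "T^2 = C2^2"
proof -
  have C2_eq: "C2 = sl21.A - sl21.B"
    unfolding C2_def H_eq Y_eq sl21.quadratic_casimir env_scale_numeral_mult
    by (simp add: env_scale_one)
  have "Z 0 = U" "Z 1 = V" "Z 2 = W" "Z 3 = X"
    by (simp_all add: Z_def)
  then have T_eq: "T = sl21.A + sl21.B"
    unfolding T_def antisymmetrizer_4 Let_def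
    \<comment> \<open>\<open>simp only\<close> leaves the 24 terms in the literal form that
      \<open>sl21.ghost_casimir\<close> expects.\<close>
    by (simp only: sl21.ghost_casimir env_scale_numeral_mult) (simp add: env_scale_one)
  show ?thesis
    unfolding T_eq C2_eq by (rule sl21.square_sum_eq_square_diff)
qed

end
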